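(* Let $X=\{x_1,\dots,x_n\}$ and $p\in[0,1]$. For $t\ge1$ let $m_t(p)=\sum_{w\in X^t}s_p(w)$, and set $m_0(p)=1$, $m_{-1}(p)=\dots=m_{-n+1}(p)=0$. Then for all $t\ge1$, $$m_t(p)=\sum_{k=1}^{n}(-1)^{k+1}\binom nk p^{\binom k2}m_{t-k}(p).$$
   Context: Order $X$ by $x_i>x_j$ for $i<j$. Let $w=w_1\cdots w_m\in X^*$, and suppose the distinct letters occurring in $w$ are $x_{i_1}>\dots>x_{i_k}$, where $x_{i_a}$ occurs $m_a\ge1$ times. Form the alphabet $X'(w)=\{x_{i_a}^s: 1\le a\le k,\ 1\le s\le m_a\}$, ordered by $x_{i_a}^s>x_{i_b}^t$ iff $a<b$, or $a=b$ and $s<t$. Define $w'\in X'(w)^*$ of length $m$ by: if $w_j$ is the $t$-th occurrence (from the left) of the letter $x_s$ in $w$, then the $j$-th letter of $w'$ is $x_s^t$. For a graph $H$ on vertex set $X'(w)$, the partially commutative monoid $M(X'(w),H)$ is the quotient of the free monoid on $X'(w)$ by the relations $ab=ba$ for $ab\in E(H)$; a word is in normal form if it is the lexicographically largest (with respect to the order on $X'(w)$) among all words representing the same element. Let $G_p(w)$ be the random graph on $X'(w)$ in which each pair $\{x_{i_a}^s,x_{i_b}^t\}$ with $a\neq b$ is an edge independently with probability $p$ (and copies of the same letter are never adjacent). The weight $s_p(w)$ is the probability that $w'$ is in normal form in $M(X'(w),G_p(w))$. *)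

theory Defs
  imports "HOL-Probability.Probability" "HOL-Probability.Product_PMF"
begin

text \<open>
  The letter \<open>x\<^sub>i\<close> is represented by its index \<open>i\<close>, and the copy of \<open>x\<^sub>i\<close> with
  superscript \<open>s\<close> by the pair \<open>(i, s)\<close>. A graph on a given vertex set is represented by its
  set of edges, each edge being a two-element set of vertices.
\<close>

definition copies :: "nat list \<Rightarrow> (nat \<times> nat) set" where
  "copies w = {(i, s). i \<in> set w \<and> 1 \<le> s \<and> s \<le> count_list w i}"

text \<open>
  \<open>(a, b) \<in> copy_less\<close> means that \<open>a\<close> is smaller than \<open>b\<close>; the letters with smaller index
  and, for equal index, the copies with smaller superscript are the \<^emph>\<open>larger\<close> ones.
\<close>

definition copy_less :: "((nat \<times> nat) \<times> (nat \<times> nat)) set" where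
  "copy_less = {((i, s), (j, t)). j < i \<or> (j = i \<and> t < s)}"

definition primed_word :: "nat list \<Rightarrow> (nat \<times> nat) list" where
  "primed_word w = map (\<lambda>j. (w ! j, count_list (take (Suc j) w) (w ! j))) [0..<length w]"

text \<open>
  The congruence on the free monoid over \<open>A\<close> generated by \<open>ab = ba\<close> for the edges
  \<open>{a, b}\<close> of \<open>E\<close>. The elements of the partially commutative monoid \<open>M(A, E)\<close> are its classes.
\<close>

inductive_set pc_cong :: "'a set \<Rightarrow> 'a set set \<Rightarrow> ('a list \<times> 'a list) set"
  for A :: "'a set" and E :: "'a set set"
  where
    comm: "\<lbrakk>a \<in> A; b \<in> A; {a, b} \<in> E\<rbrakk> \<Longrightarrow> ([a, b], [b, a]) \<in> pc_cong A E"
  | refl: "u \<in> lists A \<Longrightarrow> (u, u) \<in> pc_cong A E"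
  | sym: "(u, v) \<in> pc_cong A E \<Longrightarrow> (v, u) \<in> pc_cong A E"
  | trans: "\<lbrakk>(u, v) \<in> pc_cong A E; (v, w) \<in> pc_cong A E\<rbrakk> \<Longrightarrow> (u, w) \<in> pc_cong A E"
  | append: "\<lbrakk>(u, u') \<in> pc_cong A E; (v, v') \<in> pc_cong A E\<rbrakk> \<Longrightarrow> (u @ v, u' @ v') \<in> pc_cong A E"

definition pc_class :: "'a set \<Rightarrow> 'a set set \<Rightarrow> 'a list \<Rightarrow> 'a list set" where
  "pc_class A E u = pc_cong A E `` {u}"

definition normal_form :: "('a \<times> 'a) set \<Rightarrow> 'a set \<Rightarrow> 'a set set \<Rightarrow> 'a list \<Rightarrow> bool" where
  "normal_form r A E u \<longleftrightarrow>
     u \<in> lists A \<and>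
     (\<forall>v \<in> lists A. pc_class A E v = pc_class A E u \<longrightarrow> v = u \<or> (v, u) \<in> lexord r)"

definition copy_pairs :: "nat list \<Rightarrow> (nat \<times> nat) set set" where
  "copy_pairs w =
     {{(i, s), (j, t)} | i s j t. (i, s) \<in> copies w \<and> (j, t) \<in> copies w \<and> i \<noteq> j}"

definition random_graph :: "real \<Rightarrow> nat list \<Rightarrow> (nat \<times> nat) set set pmf" where
  "random_graph p w =
     map_pmf (\<lambda>f. {e \<in> copy_pairs w. f e})
       (Pi_pmf (copy_pairs w) False (\<lambda>_. bernoulli_pmf p))"

definition weight :: "real \<Rightarrow> nat list \<Rightarrow> real" where
  "weight p w =
     measure_pmf.prob (random_graph p w)
       {E. normal_form copy_less (copies w) E (primed_word w)}"

definition words :: "nat \<Rightarrow> nat \<Rightarrow> nat list set" where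
  "words n t = {w. set w \<subseteq> {1..n} \<and> length w = t}"

definition weight_sum :: "nat \<Rightarrow> real \<Rightarrow> int \<Rightarrow> real" where
  "weight_sum n p t =
     (if t < 0 then 0 else if t = 0 then 1 else (\<Sum>w \<in> words n (nat t). weight p w))"

end

theory Submission
  imports Defs "HOL-Computational_Algebra.Formal_Power_Series"
begin

text \<open>
  A word is in normal form iff no letter can be moved left past a block starting with a smaller
  letter. Whether the \<open>j\<close>-th letter of \<open>w'\<close> can be moved in this way depends only on the edges
  from it to the earlier letters, so these events are independent for different \<open>j\<close>. The event
  has probability \<open>p ^ d\<close> if the last earlier letter that is not larger is strictly smaller and
  lies \<open>d\<close> places to the left, and probability 0 otherwise; hence the weight is a product over
  the letters of \<open>w\<close>.

  Let \<open>M\<^sub>m\<close> be the generating function of the weights over \<open>m\<close> letters, and \<open>N\<^sub>m\<close> the one of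
  the words preceded by an extra letter smaller than all others. Splitting words at the last
  occurrence of the smallest letter gives
  \<open>M\<^sub>m\<^sub>+\<^sub>1 (1 - x N\<^sub>m) = M\<^sub>m\<close> and \<open>N\<^sub>m\<^sub>+\<^sub>1 (1 - x N\<^sub>m) = N\<^sub>m (1 - p x N\<^sub>m(p x))\<close>. The polynomials
  \<open>P\<^sub>m = \<Sum>\<^sub>k (-1)\<^sup>k (m choose k) p\<^bsup>k choose 2\<^esup> x\<^sup>k\<close> satisfy \<open>P\<^sub>m\<^sub>+\<^sub>1 = P\<^sub>m - x P\<^sub>m(p x)\<close>, so
  by induction \<open>P\<^sub>m N\<^sub>m = P\<^sub>m(p x)\<close> and \<open>P\<^sub>m M\<^sub>m = 1\<close>.
\<close>

unbundle no vec_syntax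
unbundle fps_syntax

subsection \<open>Normal forms\<close>

text \<open>Two distinct letters both survive the filter only if they are \<open>x\<close> and
  \<open>y\<close> themselves, which would make \<open>{x, y}\<close> an edge.\<close>

lemma filter_pair_swap:
  assumes "{a, b} \<in> E" "{x, y} \<notin> E"
  shows "filter (\<lambda>c. c = x \<or> c = y) [a, b] = filter (\<lambda>c. c = x \<or> c = y) [b, a]"
  using assms by (auto simp: insert_commute)

text \<open>Projections onto non-commuting pairs are the invariants that show which letters cannot
  have crossed each other. Only the generating swaps need an argument.\<close>

lemma pc_cong_filter_eq:
  assumes "(u, v) \<in> pc_cong A E" "{x, y} \<notin> E"
  shows "filter (\<lambda>c. c = x \<or> c = y) u = filter (\<lambda>c. c = x \<or> c = y) v"
  using assms
proof (induction rule: pc_cong.induct)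
  case (comm a b)
  then show ?case by (intro filter_pair_swap)
qed auto

lemma pc_cong_mset:
  assumes "(u, v) \<in> pc_cong A E"
  shows "mset u = mset v"
  using assms by (induction rule: pc_cong.induct) auto

lemma pc_class_eq_iff:
  assumes "u \<in> lists A"
  shows "pc_class A E v = pc_class A E u \<longleftrightarrow> (v, u) \<in> pc_cong A E"
proof
  assume "pc_class A E v = pc_class A E u"
  moreover have "u \<in> pc_class A E u"
    using pc_cong.refl[OF assms] by (simp add: pc_class_def)
  ultimately have "u \<in> pc_class A E v" by simp
  then show "(v, u) \<in> pc_cong A E" by (simp add: pc_class_def)
next
  assume vu: "(v, u) \<in> pc_cong A E"
  have "(v, x) \<in> pc_cong A E \<longleftrightarrow> (u, x) \<in> pc_cong A E" for x
    using pc_cong.trans[OF vu] pc_cong.trans[OF pc_cong.sym[OF vu]] by blast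
  then show "pc_class A E v = pc_class A E u" by (auto simp: pc_class_def)
qed

lemma pc_cong_move_front:
  assumes "set y \<subseteq> A" "b \<in> A" "\<And>c. c \<in> set y \<Longrightarrow> {b, c} \<in> E"
  shows "(y @ [b], b # y) \<in> pc_cong A E"
  using assms
proof (induction y)
  case Nil
  then show ?case by (auto intro: pc_cong.refl)
next
  case (Cons c y)
  have "([c], [c]) \<in> pc_cong A E" "(y, y) \<in> pc_cong A E"
    using Cons.prems by (auto intro!: pc_cong.refl)
  moreover have "([c, b], [b, c]) \<in> pc_cong A E"
    using Cons.prems by (intro pc_cong.comm) (auto simp: insert_commute[of c b])
  moreover have "(y @ [b], b # y) \<in> pc_cong A E"
    using Cons by simp
  ultimately have "([c] @ (y @ [b]), [c] @ (b # y)) \<in> pc_cong A E"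
    "([c, b] @ y, [b, c] @ y) \<in> pc_cong A E"
    by (blast intro: pc_cong.append)+
  then have "(c # (y @ [b]), c # b # y) \<in> pc_cong A E" "(c # b # y, b # c # y) \<in> pc_cong A E"
    by simp_all
  then show ?case unfolding append_Cons by (rule pc_cong.trans)
qed

lemma first_difference:
  assumes "length u = length v" "u \<noteq> v"
  obtains pre a b u' v' where "u = pre @ a # u'" "v = pre @ b # v'" "a \<noteq> b"
  using assms
proof (induction u v arbitrary: thesis rule: list_induct2')
  case (4 x xs y ys)
  show ?case
  proof (cases "x = y")
    case True
    then obtain pre a b u' v' where "xs = pre @ a # u'" "ys = pre @ b # v'" "a \<noteq> b"
      using 4 by (metis length_Cons nat.inject)
    then show ?thesis using 4(2)[of "x # pre" a u' b v'] True by simp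
  next
    case False
    then show ?thesis using 4(2)[of "[]"] by simp
  qed
qed auto

text \<open>Here \<open>b\<close> commutes with the whole block \<open>a # y\<close>, so it may jump
  in front of it; as \<open>a\<close> is smaller than \<open>b\<close>, this makes the word
  lexicographically larger.\<close>

definition has_descent :: "('a \<times> 'a) set \<Rightarrow> 'a set set \<Rightarrow> 'a list \<Rightarrow> bool" where
  "has_descent r E u \<longleftrightarrow> (\<exists>pre a y b z. u = pre @ a # y @ b # z \<and> (a, b) \<in> r \<and>
     (\<forall>c \<in> set (a # y). {b, c} \<in> E))"

lemma descent_not_normal_form:
  assumes "asym r" "u \<in> lists A" "has_descent r E u"
  shows "\<not> normal_form r A E u"
proof
  assume nf: "normal_form r A E u"
  obtain pre a y b z where u: "u = pre @ a # y @ b # z" and ab: "(a, b) \<in> r"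
    and adj: "\<forall>c \<in> set (a # y). {b, c} \<in> E"
    using assms(3) unfolding has_descent_def by blast
  let ?v = "pre @ (b # a # y) @ z"
  have "(pre, pre) \<in> pc_cong A E" "(z, z) \<in> pc_cong A E"
    using assms(2) u by (auto intro!: pc_cong.refl)
  moreover have "((a # y) @ [b], b # (a # y)) \<in> pc_cong A E"
    using assms(2) u adj by (intro pc_cong_move_front) auto
  ultimately have "(pre @ ((a # y) @ [b]) @ z, ?v) \<in> pc_cong A E"
    by (intro pc_cong.append)
  then have "(?v, u) \<in> pc_cong A E" using u by (auto intro: pc_cong.sym)
  moreover have "?v \<in> lists A" using assms(2) u by auto
  ultimately have "?v = u \<or> (?v, u) \<in> lexord r"
    using nf pc_class_eq_iff[OF assms(2)] unfolding normal_form_def by blast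
  moreover have "(u, ?v) \<in> lexord r"
    using ab u by (simp add: lexord_append_leftI)
  moreover have "asym (lexord r)" using assms(1) by (rule lexord_asym)
  ultimately show False by (metis asymD)
qed

text \<open>At the first difference from an equivalent word \<open>v\<close>, let \<open>u\<close>
  have \<open>a\<close> and \<open>v\<close> have \<open>b\<close>. The next \<open>b\<close> in
  \<open>u\<close> must commute with everything from \<open>a\<close> up to it, so \<open>a\<close>
  smaller than \<open>b\<close> would give a descent.\<close>

lemma no_descent_normal_form:
  assumes "total r" "u \<in> lists A" "\<not> has_descent r E u"
  shows "normal_form r A E u"
  unfolding normal_form_def
proof (intro conjI ballI impI)
  fix v assume "v \<in> lists A" "pc_class A E v = pc_class A E u"
  then have cong: "(v, u) \<in> pc_cong A E" using pc_class_eq_iff[OF assms(2)] by blast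
  show "v = u \<or> (v, u) \<in> lexord r"
  proof (cases "v = u")
    case False
    have mset: "mset v = mset u" using cong by (rule pc_cong_mset)
    have "length u = length v" using mset by (metis mset_eq_length)
    then obtain pre a b u' v' where uv: "u = pre @ a # u'" "v = pre @ b # v'" "a \<noteq> b"
      by (rule first_difference[OF _ not_sym[OF False]])
    then have "mset (b # v') = mset (a # u')" using mset by simp
    then have "set (b # v') = set (a # u')" by (rule mset_eq_setD)
    then have "b \<in> set u'" using uv(3) by auto
    then obtain y z where u': "u' = y @ b # z" "b \<notin> set y"
      by (metis split_list_first)
    have adj: "{b, c} \<in> E" if "c \<in> set (a # y)" for c
    proof (rule ccontr)
      assume "{b, c} \<notin> E"
      let ?P = "\<lambda>d. d = b \<or> d = c"
      have "filter ?P v = filter ?P u"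
        using cong \<open>{b, c} \<notin> E\<close> by (rule pc_cong_filter_eq)
      \<comment> \<open>After the projection of \<open>pre\<close> is cancelled, the side of
        \<open>v\<close> starts with \<open>b\<close>, whereas the side of \<open>u\<close> starts
        inside \<open>a # y\<close>, which contains \<open>c\<close> but no
        \<open>b\<close>.\<close>
      then have eq: "b # filter ?P v' = filter ?P (a # y) @ filter ?P (b # z)"
        using uv u' by auto
      moreover have "filter ?P (a # y) \<noteq> []" using that by (auto simp: filter_empty_conv)
      ultimately have "b \<in> set (filter ?P (a # y))"
        by (cases "filter ?P (a # y)") (simp_all del: filter.simps)
      then show False using u'(2) uv(3) by (simp only: set_filter) auto
    qed
    have "(a, b) \<notin> r"
      using assms(3) uv(1) u'(1) adj unfolding has_descent_def by blast
    then have "(b, a) \<in> r" using assms(1) uv(3) by (auto simp: total_on_def)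
    then show ?thesis using uv by (auto intro: lexord_append_leftI)
  qed simp
qed (use assms in auto)

lemma normal_form_iff_no_descent:
  assumes "asym r" "total r" "u \<in> lists A"
  shows "normal_form r A E u \<longleftrightarrow> \<not> has_descent r E u"
  using assms descent_not_normal_form no_descent_normal_form by metis

text \<open>From here on words are reversed: the head of the list is the last letter.\<close>

primrec descent_at :: "('a \<times> 'a) set \<Rightarrow> 'a set set \<Rightarrow> 'a \<Rightarrow> 'a list \<Rightarrow> bool" where
  "descent_at r E b [] \<longleftrightarrow> False"
| "descent_at r E b (c # u) \<longleftrightarrow> {b, c} \<in> E \<and> ((c, b) \<in> r \<or> descent_at r E b u)"

text \<open>The recursion walks leftwards from \<open>b\<close> while the letters met are adjacent
  to it, and succeeds at a smaller one. This translates it into the form used in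
  \<open>has_descent\<close>.\<close>

lemma descent_at_iff:
  "descent_at r E b u \<longleftrightarrow>
     (\<exists>y a pre. u = y @ a # pre \<and> (a, b) \<in> r \<and> (\<forall>c \<in> set (a # y). {b, c} \<in> E))"
proof (induction u)
  case (Cons c u)
  show ?case
  proof
    assume "descent_at r E b (c # u)"
    then consider "{b, c} \<in> E" "(c, b) \<in> r" | "{b, c} \<in> E" "descent_at r E b u"
      by auto
    then show "\<exists>y a pre. c # u = y @ a # pre \<and> (a, b) \<in> r \<and> (\<forall>d \<in> set (a # y). {b, d} \<in> E)"
    proof cases
      case 1
      then show ?thesis by (intro exI[of _ "[]"] exI[of _ c] exI[of _ u]) auto
    next
      case 2
      then obtain y a pre where "u = y @ a # pre" "(a, b) \<in> r" "\<forall>c \<in> set (a # y). {b, c} \<in> E"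
        using Cons by blast
      then show ?thesis using 2 by (intro exI[of _ "c # y"] exI[of _ a] exI[of _ pre]) auto
    qed
  next
    assume "\<exists>y a pre. c # u = y @ a # pre \<and> (a, b) \<in> r \<and> (\<forall>d \<in> set (a # y). {b, d} \<in> E)"
    then obtain y a pre where *: "c # u = y @ a # pre" "(a, b) \<in> r" "\<forall>d \<in> set (a # y). {b, d} \<in> E"
      by blast
    show "descent_at r E b (c # u)"
      using * Cons by (cases y) auto
  qed
qed auto

primrec descent_free :: "('a \<times> 'a) set \<Rightarrow> 'a set set \<Rightarrow> 'a list \<Rightarrow> bool" where
  "descent_free r E [] \<longleftrightarrow> True"
| "descent_free r E (b # u) \<longleftrightarrow> descent_free r E u \<and> \<not> descent_at r E b u"

text \<open>The letter moved by a descent is either the last one or an earlier one; in the second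
  case the descent lies inside \<open>u\<close>.\<close>

lemma has_descent_snoc:
  "has_descent r E (u @ [b]) \<longleftrightarrow> has_descent r E u \<or> descent_at r E b (rev u)"
proof
  assume "has_descent r E (u @ [b])"
  then obtain pre a y d z where *: "u @ [b] = pre @ a # y @ d # z" "(a, d) \<in> r"
    "\<forall>c \<in> set (a # y). {d, c} \<in> E"
    unfolding has_descent_def by blast
  show "has_descent r E u \<or> descent_at r E b (rev u)"
  proof (cases z rule: rev_cases)
    case Nil
    then have "b = d" "rev u = rev y @ a # rev pre" using *(1) by auto
    then show ?thesis using * unfolding descent_at_iff by fastforce
  next
    case (snoc z' d')
    then have "u = pre @ a # y @ d # z'" using *(1) by auto
    then show ?thesis using * unfolding has_descent_def by blast
  qed
next
  assume "has_descent r E u \<or> descent_at r E b (rev u)"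
  then show "has_descent r E (u @ [b])"
  proof
    assume "has_descent r E u"
    then obtain pre a y d z where *: "u = pre @ a # y @ d # z" "(a, d) \<in> r"
      "\<forall>c \<in> set (a # y). {d, c} \<in> E"
      unfolding has_descent_def by blast
    then have "u @ [b] = pre @ a # y @ d # (z @ [b])" by simp
    then show ?thesis using * unfolding has_descent_def by blast
  next
    assume "descent_at r E b (rev u)"
    then obtain y a pre where *: "rev u = y @ a # pre" "(a, b) \<in> r" "\<forall>c \<in> set (a # y). {b, c} \<in> E"
      unfolding descent_at_iff by blast
    then have "u = rev (y @ a # pre)" by (metis rev_rev_ident)
    then have "u @ [b] = rev pre @ a # rev y @ b # []" by simp
    moreover have "\<forall>c \<in> set (a # rev y). {b, c} \<in> E" using * by simp
    ultimately show ?thesis using *(2) unfolding has_descent_def by blast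
  qed
qed

lemma descent_free_rev: "descent_free r E (rev u) \<longleftrightarrow> \<not> has_descent r E u"
proof (induction u rule: rev_induct)
  case Nil
  then show ?case by (auto simp: has_descent_def)
qed (auto simp: has_descent_snoc)

subsection \<open>Random edge sets\<close>

definition random_subset :: "real \<Rightarrow> 'a set \<Rightarrow> 'a set pmf" where
  "random_subset p F = map_pmf (\<lambda>f. {e \<in> F. f e}) (Pi_pmf F False (\<lambda>_. bernoulli_pmf p))"

lemma set_pmf_random_subset: "set_pmf (random_subset p F) \<subseteq> Pow F"
  by (auto simp: random_subset_def)

lemma random_subset_Un:
  assumes "finite F" "finite G" "F \<inter> G = {}"
  shows "random_subset p (F \<union> G) =
    map_pmf (\<lambda>(E1, E2). E1 \<union> E2) (pair_pmf (random_subset p F) (random_subset p G))"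
proof -
  have "{e \<in> F \<union> G. if e \<in> F then f e else g e} = {e \<in> F. f e} \<union> {e \<in> G. g e}" for f g
    using assms(3) by auto
  then show ?thesis
    unfolding random_subset_def Pi_pmf_union[OF assms] pair_map_pmf1 pair_map_pmf2
    by (simp add: map_pmf_comp case_prod_unfold)
qed

text \<open>Independence of events that look at disjoint sets of edges; it allows the edges to be
  exposed in portions.\<close>

lemma prob_random_subset_Un:
  assumes "finite F" "finite G" "F \<inter> G = {}"
    and "\<And>E1 E2. E1 \<subseteq> F \<Longrightarrow> E2 \<subseteq> G \<Longrightarrow> R (E1 \<union> E2) \<longleftrightarrow> P E1 \<and> Q E2"
  shows "measure_pmf.prob (random_subset p (F \<union> G)) {E. R E} =
    measure_pmf.prob (random_subset p F) {E. P E} * measure_pmf.prob (random_subset p G) {E. Q E}"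
proof -
  let ?M = "pair_pmf (random_subset p F) (random_subset p G)"
  have "measure_pmf.prob (random_subset p (F \<union> G)) {E. R E} =
      measure_pmf.prob ?M {(E1, E2). R (E1 \<union> E2)}"
    unfolding random_subset_Un[OF assms(1-3)]
    by (simp add: vimage_def case_prod_unfold)
  \<comment> \<open>Cutting down to power sets changes nothing on the support and makes both factors
    finite, hence countable as the product rule requires.\<close>
  also have "\<dots> = measure_pmf.prob ?M ({E \<in> Pow F. P E} \<times> {E \<in> Pow G. Q E})"
  proof -
    have "R (E1 \<union> E2) \<longleftrightarrow> E1 \<in> Pow F \<and> P E1 \<and> E2 \<in> Pow G \<and> Q E2"
      if "(E1, E2) \<in> set_pmf ?M" for E1 E2
      using that assms(4)[of E1 E2] set_pmf_random_subset[of p F] set_pmf_random_subset[of p G]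
      by auto
    then show ?thesis
      by (intro measure_prob_cong_0) (auto simp: pmf_eq_0_set_pmf simp del: set_pair_pmf)
  qed
  also have "\<dots> = measure_pmf.prob (random_subset p F) {E \<in> Pow F. P E} *
      measure_pmf.prob (random_subset p G) {E \<in> Pow G. Q E}"
    using assms(1,2) by (intro measure_pmf_prob_product) (auto intro: countable_finite)
  also have "measure_pmf.prob (random_subset p F) {E \<in> Pow F. P E} =
      measure_pmf.prob (random_subset p F) {E. P E}"
    using set_pmf_random_subset[of p F]
    by (intro measure_prob_cong_0) (auto simp: pmf_eq_0_set_pmf)
  also have "measure_pmf.prob (random_subset p G) {E \<in> Pow G. Q E} =
      measure_pmf.prob (random_subset p G) {E. Q E}"
    using set_pmf_random_subset[of p G]
    by (intro measure_prob_cong_0) (auto simp: pmf_eq_0_set_pmf)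
  finally show ?thesis .
qed

lemma prob_random_subset_singleton:
  assumes "0 \<le> p" "p \<le> 1"
  shows "measure_pmf.prob (random_subset p {e}) {E. e \<in> E} = p"
proof -
  have "measure_pmf.prob (random_subset p {e}) {E. e \<in> E} =
     measure_pmf.prob (bernoulli_pmf p) {b. b}"
    by (simp add: random_subset_def Pi_pmf_singleton map_pmf_comp vimage_def)
  also have "{b. b} = {True}" by auto
  finally show ?thesis using assms by (simp add: measure_pmf_single)
qed

lemma prob_random_subset_cong:
  assumes "\<And>E. E \<subseteq> F \<Longrightarrow> P E \<longleftrightarrow> Q E"
  shows "measure_pmf.prob (random_subset p F) {E. P E} =
    measure_pmf.prob (random_subset p F) {E. Q E}"
  using assms set_pmf_random_subset[of p F]
  by (intro measure_prob_cong_0) (auto simp: pmf_eq_0_set_pmf)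

subsection \<open>The weight as a product over the letters\<close>

text \<open>The possible edges from a new last letter to the earlier ones. Comparing first
  components excludes copies of the same letter.\<close>

definition star :: "'a \<times> 'b \<Rightarrow> ('a \<times> 'b) set \<Rightarrow> ('a \<times> 'b) set set" where
  "star b V = (\<lambda>c. {b, c}) ` {c \<in> V. fst c \<noteq> fst b}"

primrec pairs :: "('a \<times> 'b) list \<Rightarrow> ('a \<times> 'b) set set" where
  "pairs [] = {}"
| "pairs (b # u) = pairs u \<union> star b (set u)"

text \<open>
  The parameter \<open>z\<close> is the value at the left end of the word: \<open>z = 0\<close> is the word itself, and
  \<open>z = p\<close> the word preceded by a letter smaller than all its letters and \<open>a\<close>.
\<close>

primrec move_prob :: "real \<Rightarrow> real \<Rightarrow> nat \<Rightarrow> nat list \<Rightarrow> real" where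
  "move_prob p z a [] = z"
| "move_prob p z a (c # u) = (if c = a then 0 else if a < c then p else p * move_prob p z a u)"

primrec word_weight :: "real \<Rightarrow> real \<Rightarrow> nat list \<Rightarrow> real" where
  "word_weight p z [] = 1"
| "word_weight p z (a # u) = word_weight p z u * (1 - move_prob p z a u)"

lemma finite_star: "finite V \<Longrightarrow> finite (star b V)"
  unfolding star_def by simp

lemma finite_pairs: "finite (pairs u)"
  by (induction u) (auto simp: finite_star)

lemma pairs_subset: "e \<in> pairs u \<Longrightarrow> e \<subseteq> set u"
  by (induction u) (auto simp: star_def)

lemma in_pairs_iff: "e \<in> pairs u \<longleftrightarrow> (\<exists>c \<in> set u. \<exists>d \<in> set u. fst c \<noteq> fst d \<and> e = {c, d})"
proof (induction u)
  case (Cons b u)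
  have star: "e \<in> star b (set u) \<longleftrightarrow> (\<exists>d \<in> set u. fst d \<noteq> fst b \<and> e = {b, d})"
    unfolding star_def image_iff mem_Collect_eq Bex_def by metis
  show ?case
  proof
    assume "e \<in> pairs (b # u)"
    then consider "e \<in> pairs u" | d where "d \<in> set u" "fst d \<noteq> fst b" "e = {b, d}"
      unfolding pairs.simps Un_iff star by metis
    then show "\<exists>c \<in> set (b # u). \<exists>d \<in> set (b # u). fst c \<noteq> fst d \<and> e = {c, d}"
    proof cases
      case 1
      then show ?thesis unfolding Cons by (meson list.set_intros(2))
    next
      case 2
      then show ?thesis by (metis list.set_intros)
    qed
  next
    assume "\<exists>c \<in> set (b # u). \<exists>d \<in> set (b # u). fst c \<noteq> fst d \<and> e = {c, d}"
    then obtain c d where e: "e = {c, d}" "c \<in> set (b # u)" "d \<in> set (b # u)" "fst c \<noteq> fst d"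
      by blast
    then consider "c \<in> set u" "d \<in> set u" | "c = b" "d \<in> set u" | "d = b" "c \<in> set u"
      by (metis set_ConsD)
    then show "e \<in> pairs (b # u)"
      unfolding pairs.simps Un_iff star Cons
    proof cases
      case 3
      then show "(\<exists>c \<in> set u. \<exists>d \<in> set u. fst c \<noteq> fst d \<and> e = {c, d}) \<or>
          (\<exists>d \<in> set u. fst d \<noteq> fst b \<and> e = {b, d})"
        using e(1,4) insert_commute[of c d "{}"] by metis
    qed (use e(1,4) in metis)+
  qed
qed simp

lemma descent_at_cong:
  assumes "\<And>c. c \<in> set u \<Longrightarrow> {b, c} \<in> E \<longleftrightarrow> {b, c} \<in> E'"
  shows "descent_at r E b u \<longleftrightarrow> descent_at r E' b u"
  using assms by (induction u) auto

lemma descent_free_cong: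
  assumes "\<And>c d. c \<in> set u \<Longrightarrow> d \<in> set u \<Longrightarrow> {c, d} \<in> E \<longleftrightarrow> {c, d} \<in> E'"
  shows "descent_free r E u \<longleftrightarrow> descent_free r E' u"
  using assms
proof (induction u)
  case (Cons b u)
  then have "descent_at r E b u \<longleftrightarrow> descent_at r E' b u"
    by (intro descent_at_cong) auto
  then show ?case using Cons by auto
qed simp

text \<open>The edges at \<open>b\<close> are exposed from right to left. A copy of the same letter
  blocks the move; any other letter costs a factor \<open>p\<close>, and a smaller one completes the
  descent. Reaching the left end is a failure, hence \<open>z = 0\<close>.\<close>

lemma prob_descent_at:
  assumes "0 \<le> p" "p \<le> 1" "distinct u" "b \<notin> set u"
  shows "measure_pmf.prob (random_subset p (star b (set u))) {E. descent_at copy_less E b u} =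
    move_prob p 0 (fst b) (map fst u)"
  using assms(3,4)
proof (induction u)
  case (Cons c u)
  let ?P = "\<lambda>F. measure_pmf.prob (random_subset p F)"
  show ?case
  proof (cases "fst c = fst b")
    case True
    then have "star b (set (c # u)) = star b (set u)" "{b, c} \<notin> star b (set u)"
      using Cons.prems by (auto simp: star_def doubleton_eq_iff)
    then have "?P (star b (set (c # u))) {E. descent_at copy_less E b (c # u)} =
        ?P (star b (set u)) {E. False}"
      by (simp only:, intro prob_random_subset_cong) auto
    then show ?thesis using True by simp
  next
    case False
    have less: "(c, b) \<in> copy_less \<longleftrightarrow> fst b < fst c"
      using False by (auto simp: copy_less_def case_prod_unfold)
    have split: "star b (set (c # u)) = {{b, c}} \<union> star b (set u)"
      and new: "{b, c} \<notin> star b (set u)"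
      using False Cons.prems by (auto simp: star_def doubleton_eq_iff)
    have "?P (star b (set (c # u))) {E. descent_at copy_less E b (c # u)} =
        ?P {{b, c}} {E. {b, c} \<in> E} *
        ?P (star b (set u)) {E. fst b < fst c \<or> descent_at copy_less E b u}"
      unfolding split
    proof (rule prob_random_subset_Un)
      fix E1 E2 assume E: "E1 \<subseteq> {{b, c}}" "E2 \<subseteq> star b (set u)"
      \<comment> \<open>By distinctness, \<open>{b, c}\<close> is none of the edges from
        \<open>b\<close> to \<open>u\<close>.\<close>
      then have "descent_at copy_less (E1 \<union> E2) b u \<longleftrightarrow> descent_at copy_less E2 b u"
        using Cons.prems by (intro descent_at_cong) (auto simp: doubleton_eq_iff)
      then show "descent_at copy_less (E1 \<union> E2) b (c # u) \<longleftrightarrow>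
          {b, c} \<in> E1 \<and> (fst b < fst c \<or> descent_at copy_less E2 b u)"
        using E new less by auto
    qed (use new in \<open>auto simp: finite_star\<close>)
    also have "\<dots> = p * (if fst b < fst c then 1 else move_prob p 0 (fst b) (map fst u))"
      using Cons by (simp add: prob_random_subset_singleton[OF assms(1,2)])
    finally show ?thesis using False by auto
  qed
qed simp

text \<open>Descents ending at the last letter involve only its own edges, all others only edges
  among earlier letters. The two conditions are therefore independent.\<close>

lemma prob_descent_free:
  assumes "0 \<le> p" "p \<le> 1" "distinct u"
  shows "measure_pmf.prob (random_subset p (pairs u)) {E. descent_free copy_less E u} =
    word_weight p 0 (map fst u)"
  using assms(3)
proof (induction u)
  case (Cons b u)
  let ?P = "\<lambda>F. measure_pmf.prob (random_subset p F)"
  have star_notin: "{c, d} \<notin> E" if "c \<in> set u" "d \<in> set u" "E \<subseteq> star b (set u)" for c d E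
    using that Cons.prems by (auto simp: star_def doubleton_eq_iff subset_iff)
  have pairs_notin: "{b, c} \<notin> E" if "E \<subseteq> pairs u" for c E
    using that pairs_subset[of "{b, c}" u] Cons.prems by auto
  have "?P (pairs (b # u)) {E. descent_free copy_less E (b # u)} =
      ?P (pairs u) {E. descent_free copy_less E u} *
      ?P (star b (set u)) {E. \<not> descent_at copy_less E b u}"
    unfolding pairs.simps
  proof (rule prob_random_subset_Un)
    show "pairs u \<inter> star b (set u) = {}"
      using pairs_notin[OF subset_refl] by (auto simp: star_def)
  next
    fix E1 E2 assume E: "E1 \<subseteq> pairs u" "E2 \<subseteq> star b (set u)"
    have "descent_free copy_less (E1 \<union> E2) u \<longleftrightarrow> descent_free copy_less E1 u"
      using star_notin[OF _ _ E(2)] by (intro descent_free_cong) auto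
    moreover have "descent_at copy_less (E1 \<union> E2) b u \<longleftrightarrow> descent_at copy_less E2 b u"
      using pairs_notin[OF E(1)] by (intro descent_at_cong) auto
    ultimately show "descent_free copy_less (E1 \<union> E2) (b # u) \<longleftrightarrow>
        descent_free copy_less E1 u \<and> \<not> descent_at copy_less E2 b u"
      by simp
  qed (auto simp: finite_pairs finite_star)
  also have "?P (star b (set u)) {E. \<not> descent_at copy_less E b u} =
      1 - move_prob p 0 (fst b) (map fst u)"
  proof -
    have "{E. \<not> descent_at copy_less E b u} = UNIV - {E. descent_at copy_less E b u}"
      by auto
    then show ?thesis
      using measure_pmf.prob_compl[of "{E. descent_at copy_less E b u}"
          "random_subset p (star b (set u))"] prob_descent_at[OF assms(1,2)] Cons.prems
      by simp
  qed
  finally show ?case using Cons by simp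
qed simp

section \<open>The primed word and the copies of its letters\<close>

lemma primed_word_snoc: "primed_word (w @ [a]) = primed_word w @ [(a, Suc (count_list w a))]"
  by (auto simp: primed_word_def nth_append intro!: map_cong)

lemma map_fst_primed_word: "map fst (primed_word w) = w"
  by (induction w rule: rev_induct) (auto simp: primed_word_snoc, simp add: primed_word_def)

lemma copies_snoc: "copies (w @ [a]) = insert (a, Suc (count_list w a)) (copies w)"
proof (rule set_eqI, clarify)
  fix i s
  have "count_list w i = 0" if "i \<notin> set w"
    using that by (simp add: count_list_0_iff)
  then show "(i, s) \<in> copies (w @ [a]) \<longleftrightarrow> (i, s) \<in> insert (a, Suc (count_list w a)) (copies w)"
    by (cases "i = a"; cases "i \<in> set w") (simp_all add: copies_def, linarith+)
qed

lemma set_primed_word: "set (primed_word w) = copies w"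
proof (induction w rule: rev_induct)
  case Nil
  then show ?case by (simp add: primed_word_def copies_def)
qed (simp add: primed_word_snoc copies_snoc)

lemma distinct_primed_word: "distinct (primed_word w)"
proof (induction w rule: rev_induct)
  case Nil
  then show ?case by (simp add: primed_word_def)
next
  case (snoc a w)
  then show ?case
    by (simp add: primed_word_snoc set_primed_word) (simp add: copies_def)
qed

lemma copy_pairs_eq: "copy_pairs w = pairs (rev (primed_word w))"
proof (rule set_eqI)
  fix e show "e \<in> copy_pairs w \<longleftrightarrow> e \<in> pairs (rev (primed_word w))"
    unfolding in_pairs_iff copy_pairs_def set_rev set_primed_word
    by auto (metis fst_conv)+
qed

lemma random_graph_eq: "random_graph p w = random_subset p (pairs (rev (primed_word w)))"
  by (simp add: random_graph_def random_subset_def copy_pairs_eq)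

lemma asym_copy_less: "asym copy_less"
  by (auto simp: asym_on_def copy_less_def)

lemma total_copy_less: "total copy_less"
  by (auto simp: total_on_def copy_less_def)

lemma normal_form_primed_word_iff:
  "normal_form copy_less (copies w) E (primed_word w) \<longleftrightarrow>
    descent_free copy_less E (rev (primed_word w))"
proof -
  have "primed_word w \<in> lists (copies w)"
    by (simp add: in_lists_conv_set set_primed_word)
  then show ?thesis
    using normal_form_iff_no_descent[OF asym_copy_less total_copy_less]
    by (simp add: descent_free_rev)
qed

lemma weight_eq_word_weight:
  assumes "0 \<le> p" "p \<le> 1"
  shows "weight p w = word_weight p 0 (rev w)"
  using prob_descent_free[OF assms, of "rev (primed_word w)"]
  by (simp add: weight_def random_graph_eq normal_form_primed_word_iff
      distinct_primed_word map_fst_primed_word flip: rev_map)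

subsection \<open>Generating functions\<close>

text \<open>The series \<open>M\<close> and \<open>N\<close> of the overview are the cases
  \<open>z = 0\<close> and \<open>z = p\<close>.\<close>

definition word_fps :: "real \<Rightarrow> real \<Rightarrow> nat \<Rightarrow> real fps" where
  "word_fps p z m = Abs_fps (\<lambda>t. \<Sum>w \<in> words m t. word_weight p z w)"

text \<open>The substitution of \<open>p x\<close> for \<open>x\<close>.\<close>

definition fps_scale :: "real \<Rightarrow> real fps \<Rightarrow> real fps" where
  "fps_scale p F = Abs_fps (\<lambda>k. p ^ k * F $ k)"

text \<open>For a probability \<open>p\<close>, the coefficients are, up to sign, the expected
  numbers of \<open>k\<close>-cliques in the random graph on \<open>m\<close> vertices with edge
  probability \<open>p\<close>.\<close>

definition clique_poly :: "real \<Rightarrow> nat \<Rightarrow> real fps" where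
  "clique_poly p m = Abs_fps (\<lambda>k. (-1) ^ k * real (m choose k) * p ^ (k choose 2))"

lemma fps_scale_diff: "fps_scale p (F - G) = fps_scale p F - fps_scale p G"
  by (simp add: fps_scale_def fps_eq_iff algebra_simps)

lemma fps_scale_mult: "fps_scale p (F * G) = fps_scale p F * fps_scale p G"
proof (rule fps_ext)
  fix k
  have "(\<Sum>i = 0..k. p ^ k * (F $ i * G $ (k - i))) =
      (\<Sum>i = 0..k. p ^ i * F $ i * (p ^ (k - i) * G $ (k - i)))"
  proof (intro sum.cong HOL.refl)
    fix i assume "i \<in> {0..k}"
    then show "p ^ k * (F $ i * G $ (k - i)) = p ^ i * F $ i * (p ^ (k - i) * G $ (k - i))"
      using power_add[of p i "k - i"] by simp
  qed
  then show "fps_scale p (F * G) $ k = (fps_scale p F * fps_scale p G) $ k"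
    by (simp add: fps_scale_def fps_mult_nth sum_distrib_left)
qed

lemma fps_scale_X: "fps_scale p fps_X = fps_const p * fps_X"
  by (simp add: fps_scale_def fps_eq_iff fps_X_def)

lemma clique_poly_0: "clique_poly p 0 = 1"
  by (auto simp: clique_poly_def fps_eq_iff binomial_eq_0)

text \<open>Pascal's rule; the factor \<open>p ^ j\<close> gained from \<open>Suc j choose 2\<close>
  over \<open>j choose 2\<close> accounts for the scaling.\<close>

lemma clique_poly_Suc: "clique_poly p (Suc m) = clique_poly p m - fps_X * fps_scale p (clique_poly p m)"
proof (rule fps_ext)
  fix k show "clique_poly p (Suc m) $ k = (clique_poly p m - fps_X * fps_scale p (clique_poly p m)) $ k"
  proof (cases k)
    case (Suc j)
    have "Suc j choose 2 = j + (j choose 2)" by (simp add: numeral_2_eq_2)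
    then show ?thesis
      by (simp add: Suc clique_poly_def fps_scale_def power_add algebra_simps)
  qed (simp add: clique_poly_def)
qed

section \<open>Splitting words at the smallest letter\<close>

lemma finite_words: "finite (words m t)"
  unfolding words_def by (simp add: finite_lists_length_eq)

text \<open>No letter of \<open>v\<close> is smaller than \<open>m\<close>, so the walk is either
  blocked by another \<open>m\<close> or pays \<open>p\<close> for every letter and reaches the left
  end.\<close>

lemma move_prob_top:
  assumes "set v \<subseteq> {..m}"
  shows "move_prob p z m v = (if m \<in> set v then 0 else z * p ^ length v)"
  using assms by (induction v) auto

text \<open>The letter \<open>m\<close> is smaller than all letters of \<open>u\<close>, so every
  walk from \<open>u\<close> that reaches it ends there with a factor \<open>p\<close>. It hides
  \<open>v\<close> and \<open>z\<close> and acts as a left end of value \<open>p\<close>.\<close>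

lemma word_weight_append:
  assumes "set u \<subseteq> {..<m}"
  shows "word_weight p z (u @ m # v) = word_weight p p u * word_weight p z (m # v)"
proof -
  have "move_prob p z a (u @ m # v) = move_prob p p a u" if "a < m" "set u \<subseteq> {..<m}" for a u
    using that by (induction u) auto
  then show ?thesis using assms by (induction u) auto
qed

text \<open>A word containing \<open>Suc m\<close> is cut at its first occurrence in the list, the
  last one in the unreversed word, so that \<open>u\<close> uses only the other letters.\<close>

lemma sum_words_Suc:
  fixes f :: "nat list \<Rightarrow> real"
  shows "(\<Sum>w \<in> words (Suc m) t. f w) = (\<Sum>w \<in> words m t. f w) +
    (\<Sum>i < t. \<Sum>u \<in> words m i. \<Sum>v \<in> words (Suc m) (t - Suc i). f (u @ Suc m # v))"
proof -
  let ?N = "{w \<in> words (Suc m) t. Suc m \<in> set w}"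
  let ?join = "\<lambda>(i :: nat, u, v). u @ Suc m # v"
  let ?P = "\<lambda>c. c \<noteq> Suc m"
  let ?split = "\<lambda>w. (length (takeWhile ?P w), takeWhile ?P w, tl (dropWhile ?P w))"
  have upto: "{1..Suc m} = insert (Suc m) {1..m}" by auto
  have "words (Suc m) t = words m t \<union> ?N"
    unfolding words_def upto by blast
  moreover have "words m t \<inter> ?N = {}"
    by (auto simp: words_def)
  ultimately have "sum f (words (Suc m) t) = sum f (words m t) + sum f ?N"
    using sum.union_disjoint[of "words m t" ?N f] by (simp add: finite_words)
  also have "sum f ?N = (\<Sum>(i, u, v) \<in> (SIGMA i:{..<t}. words m i \<times> words (Suc m) (t - Suc i)).
      f (u @ Suc m # v))" (is "_ = sum ?g ?S")
  proof (rule sum.reindex_bij_witness)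
    fix w assume "w \<in> ?N"
    then obtain u v where w: "w = u @ Suc m # v" "Suc m \<notin> set u"
      by (metis (no_types, lifting) mem_Collect_eq split_list_first)
    have set_w: "set w \<subseteq> {1..Suc m}" and len: "length w = t"
      using \<open>w \<in> ?N\<close> by (auto simp: words_def)
    have "set u \<subseteq> {1..m}" using set_w w unfolding upto by auto
    then have mem: "(length u, u, v) \<in> ?S"
      using set_w len w(1) by (auto simp: words_def)
    have split_w: "?split w = (length u, u, v)"
      unfolding w(1) using w(2) by (auto simp: takeWhile_append dropWhile_append)
    show "?join (?split w) = w" "?split w \<in> ?S" "?g (?split w) = f w"
      using mem unfolding split_w by (simp_all add: w(1))
  next
    fix x assume "x \<in> ?S"
    then obtain i u v where x: "x = (i, u, v)" "i < t" "u \<in> words m i" "v \<in> words (Suc m) (t - Suc i)"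
      by auto
    then have "Suc m \<notin> set u" by (auto simp: words_def)
    then show "?split (?join x) = x"
      using x(1,3) by (auto simp: takeWhile_append dropWhile_append words_def)
    show "?join x \<in> ?N"
      using x(2-4) unfolding x(1) words_def upto by auto
  qed
  also have "\<dots> = (\<Sum>i < t. \<Sum>u \<in> words m i. \<Sum>v \<in> words (Suc m) (t - Suc i). f (u @ Suc m # v))"
    by (simp add: sum.cartesian_product sum.Sigma finite_words)
  finally show ?thesis .
qed

text \<open>The leading letter contributes the factor 1 if \<open>Suc m\<close> recurs in
  \<open>v\<close>, and \<open>1 - z * p ^ t\<close> if \<open>v\<close> is a word over the first
  \<open>m\<close> letters; \<open>p ^ t\<close> becomes the scaling.\<close>

lemma sum_word_weight_top:
  "(\<Sum>v \<in> words (Suc m) t. word_weight p z (Suc m # v)) =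
    (word_fps p z (Suc m) - fps_const z * fps_scale p (word_fps p z m)) $ t"
proof -
  have sub: "words m t \<subseteq> words (Suc m) t" by (auto simp: words_def)
  have "word_weight p z (Suc m # v) =
      word_weight p z v - (if v \<in> words m t then z * (p ^ t * word_weight p z v) else 0)"
    if "v \<in> words (Suc m) t" for v
  proof -
    have "v \<in> words m t \<longleftrightarrow> Suc m \<notin> set v"
      using that by (auto simp: words_def subset_iff le_Suc_eq)
    moreover have "set v \<subseteq> {..Suc m}" using that by (auto simp: words_def)
    moreover have "length v = t" using that by (simp add: words_def)
    ultimately show ?thesis
      by (simp add: move_prob_top algebra_simps)
  qed
  then have "(\<Sum>v \<in> words (Suc m) t. word_weight p z (Suc m # v)) =
      (\<Sum>v \<in> words (Suc m) t. word_weight p z v) -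
      (\<Sum>v \<in> words (Suc m) t. if v \<in> words m t then z * (p ^ t * word_weight p z v) else 0)"
    by (simp add: sum_subtractf del: word_weight.simps)
  also have "(\<Sum>v \<in> words (Suc m) t. if v \<in> words m t then z * (p ^ t * word_weight p z v) else 0) =
      (\<Sum>v \<in> words m t. z * (p ^ t * word_weight p z v))"
    using sub by (simp add: sum.If_cases finite_words Int_absorb1)
  finally show ?thesis
    by (simp add: word_fps_def fps_scale_def sum_distrib_left)
qed

lemma word_fps_0: "word_fps p z 0 = 1"
proof (rule fps_ext)
  fix t
  have "words 0 t = (if t = 0 then {[]} else {})" by (auto simp: words_def)
  then show "word_fps p z 0 $ t = 1 $ t" by (simp add: word_fps_def)
qed

text \<open>The sum over cut positions is a convolution, and \<open>fps_X\<close> marks the letter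
  at the cut. Keeping \<open>z\<close> general yields the recursions for \<open>M\<close> and
  \<open>N\<close> together.\<close>

lemma word_fps_Suc:
  "word_fps p z (Suc m) = word_fps p z m + fps_X * (word_fps p p m *
    (word_fps p z (Suc m) - fps_const z * fps_scale p (word_fps p z m)))"
  (is "_ = _ + fps_X * (_ * ?D)")
proof (rule fps_ext)
  fix t
  have "(\<Sum>i < t. \<Sum>u \<in> words m i. \<Sum>v \<in> words (Suc m) (t - Suc i).
      word_weight p z (u @ Suc m # v)) = (\<Sum>i < t. word_fps p p m $ i * ?D $ (t - Suc i))"
  proof (rule sum.cong[OF HOL.refl])
    fix i
    have "word_weight p z (u @ Suc m # v) = word_weight p p u * word_weight p z (Suc m # v)"
      if "u \<in> words m i" for u v
      using that by (intro word_weight_append) (auto simp: words_def)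
    then show "(\<Sum>u \<in> words m i. \<Sum>v \<in> words (Suc m) (t - Suc i).
        word_weight p z (u @ Suc m # v)) = word_fps p p m $ i * ?D $ (t - Suc i)"
      unfolding sum_word_weight_top[symmetric]
      by (simp add: word_fps_def sum_product del: word_weight.simps)
  qed
  also have "\<dots> = (fps_X * (word_fps p p m * ?D)) $ t"
  proof (cases t)
    case (Suc s)
    then show ?thesis
      by (simp only: fps_X_mult_nth fps_mult_nth[of "word_fps p p m"] lessThan_Suc_atMost
          atLeast0AtMost diff_Suc_Suc diff_Suc_1 nat.simps if_False)
  qed simp
  finally show "word_fps p z (Suc m) $ t = (word_fps p z m + fps_X * (word_fps p p m * ?D)) $ t"
    using sum_words_Suc[of "word_weight p z" m t] by (simp add: word_fps_def)
qed

section \<open>Solving the recursions\<close>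

lemma clique_poly_mult_barrier:
  "clique_poly p m * word_fps p p m = fps_scale p (clique_poly p m)"
proof (induction m)
  case 0
  have "fps_scale p 1 = 1" by (auto simp: fps_scale_def fps_eq_iff)
  then show ?case by (simp add: clique_poly_0 word_fps_0)
next
  case (Suc m)
  define P N N' where "P = clique_poly p m" and "N = word_fps p p m" and "N' = word_fps p p (Suc m)"
  \<comment> \<open>Used twice below: to factor \<open>P\<close> out of the product, and to
    recognise \<open>fps_scale p (P * N)\<close> as a double scaling of \<open>P\<close>.\<close>
  have PN: "P * N = fps_scale p P" using Suc by (simp add: P_def N_def)
  have "N' = N + fps_X * (N * (N' - fps_const p * fps_scale p N))"
    unfolding N_def N'_def by (rule word_fps_Suc)
  then have N': "N' - fps_X * N * N' = N - fps_const p * fps_X * N * fps_scale p N"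
    by (simp add: algebra_simps)
  have "clique_poly p (Suc m) * N' = P * N' - fps_X * (P * N) * N'"
    by (simp add: clique_poly_Suc PN P_def[symmetric] left_diff_distrib mult.assoc)
  also have "\<dots> = P * (N' - fps_X * N * N')" by (simp add: algebra_simps)
  also have "\<dots> = P * N - fps_const p * fps_X * (P * N) * fps_scale p N"
    unfolding N' by (simp add: algebra_simps)
  also have "\<dots> = fps_scale p P - fps_const p * fps_X * fps_scale p (P * N)"
    using fps_scale_mult[of p P N] by (simp add: PN mult.assoc)
  also have "\<dots> = fps_scale p (clique_poly p (Suc m))"
    by (simp add: clique_poly_Suc P_def[symmetric] fps_scale_diff fps_scale_mult fps_scale_X PN)
  finally show ?case by (simp add: N'_def)
qed

text \<open>The barrier identity turns the scaled polynomial in \<open>clique_poly_Suc\<close> into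
  \<open>?P * ?N\<close>, so \<open>?P\<close> factors out. What remains is the recursion at
  \<open>z = 0\<close>, where the correction term vanishes.\<close>

lemma clique_poly_mult_word_fps: "clique_poly p m * word_fps p 0 m = 1"
proof (induction m)
  case (Suc m)
  let ?P = "clique_poly p m" and ?N = "word_fps p p m" and ?M = "word_fps p 0 (Suc m)"
  have "clique_poly p (Suc m) * ?M = ?P * ?M - fps_X * (?P * ?N) * ?M"
    by (simp add: clique_poly_Suc clique_poly_mult_barrier algebra_simps)
  also have "\<dots> = ?P * (?M - fps_X * (?N * ?M))" by (simp add: algebra_simps)
  also have "?M - fps_X * (?N * ?M) = word_fps p 0 m"
    using word_fps_Suc[of p 0 m] by (simp add: algebra_simps)
  finally show ?case using Suc by simp
qed (simp add: clique_poly_0 word_fps_0)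

lemma weight_sum_eq_word_fps:
  assumes "0 \<le> p" "p \<le> 1"
  shows "weight_sum n p (int t) = word_fps p 0 n $ t"
proof (cases "t = 0")
  case True
  have "words n 0 = {[]}" by (auto simp: words_def)
  then show ?thesis using True by (simp add: weight_sum_def word_fps_def)
next
  case False
  \<comment> \<open>Reversal permutes the words of a given length.\<close>
  have "(\<Sum>w \<in> words n t. weight p w) = (\<Sum>w \<in> words n t. word_weight p 0 w)"
    by (rule sum.reindex_bij_witness[where i = rev and j = rev])
      (auto simp: words_def weight_eq_word_weight[OF assms])
  then show ?thesis using False by (simp add: weight_sum_def word_fps_def)
qed

theorem theorem5p2:
  fixes n :: nat and p :: real and t :: int
  assumes "0 \<le> p" and "p \<le> 1" and "t \<ge> 1"
  shows "weight_sum n p t =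
    (\<Sum>k = 1..n. (-1) ^ (k + 1) * real (n choose k) * p ^ (k choose 2) * weight_sum n p (t - int k))"
proof -
  obtain s where t: "t = int s" "s > 0" using that[of "nat t"] assms(3) by simp
  \<comment> \<open>The term \<open>c 0\<close> is the left-hand side of the theorem; moving the
    others across the equation changes \<open>(-1) ^ k\<close> into
    \<open>(-1) ^ (k + 1)\<close>.\<close>
  define c where "c k = (-1) ^ k * real (n choose k) * p ^ (k choose 2) * weight_sum n p (t - int k)" for k
  \<comment> \<open>The product is 1, and its coefficient at \<open>s\<close> is 0 because
    \<open>s > 0\<close>.\<close>
  have "0 = (clique_poly p n * word_fps p 0 n) $ s"
    using t(2) by (simp add: clique_poly_mult_word_fps)
  also have "\<dots> = (\<Sum>k = 0..s. c k)"
    unfolding fps_mult_nth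
  proof (intro sum.cong HOL.refl)
    fix k assume "k \<in> {0..s}"
    then have "t - int k = int (s - k)" using t(1) by simp
    then show "clique_poly p n $ k * word_fps p 0 n $ (s - k) = c k"
      by (simp add: c_def clique_poly_def weight_sum_eq_word_fps[OF assms(1,2)])
  qed
  \<comment> \<open>The summation range changes from \<open>s\<close> to \<open>n\<close> through
    the maximum: terms with \<open>k > s\<close> vanish by the zero convention at negative indices,
    those with \<open>k > n\<close> by the binomial coefficient.\<close>
  also have "\<dots> = (\<Sum>k = 0..max n s. c k)"
    by (intro sum.mono_neutral_left) (auto simp: c_def weight_sum_def t(1))
  also have "\<dots> = (\<Sum>k = 0..n. c k)"
    by (intro sum.mono_neutral_right) (auto simp: c_def binomial_eq_0)
  also have "\<dots> = weight_sum n p t + (\<Sum>k = 1..n. c k)"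
    using sum.atLeast_Suc_atMost[of 0 n c] by (simp add: c_def numeral_2_eq_2)
  finally have "weight_sum n p t = (\<Sum>k = 1..n. - c k)"
    by (simp add: sum_negf)
  then show ?thesis by (simp add: c_def)
qed

end
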